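(* Let $n\in\mathbb{N}$ and $q_1,\ldots,q_n\in(0,1)$. For each $c\in\mathbb{N}$ let $Y_1^{(c)},\ldots,Y_n^{(c)}$ be independent with $Y_j^{(c)}\sim\mathrm{NegBin}(c,q_j)$, and let $Y_{n:n}^{(c)}=\max_jY_j^{(c)}$. Then $\mathbb{E}[Y_{n:n}^{(c)}/c]$ is decreasing in $c$; that is, for every $c\in\mathbb{N}$, $$\frac{1}{c}\mathbb{E}[Y_{n:n}^{(c)}]-\frac{1}{c+1}\mathbb{E}[Y_{n:n}^{(c+1)}]>0.$$
   Context: $\mathbb{N}=\{1,2,\ldots\}$. $\mathrm{NegBin}(c,q)$ is the law of the sum of $c$ independent geometric random variables on $\{1,2,\ldots\}$ with success probability $q$. This is the setting of state-independent receptions (infinite field size) and heterogeneous receivers: $Y_{n:n}^{(c)}$ is the number of time slots needed to broadcast a block of $c$ packets by random linear combinations to $n$ receivers over independent erasure channels with reception probabilities $q_1,\ldots,q_n$, and $\mathbb{E}[Y_{n:n}^{(c)}/c]$ is the expected delay per packet.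
   Formalization: The strict inequality > 0 is proved for n ≥ 2, and for n = 1 only ≥ 0 is stated, because for n = 1 one has E[Y_{1:1}^{(c)}]/c = 1/q_1 for every c, so the difference is exactly 0 and the strict claim fails. *)

theory Defs
  imports "HOL-Probability.Probability"
begin

(* The library's geometric_pmf counts failures, so its support starts at 0; Suc shifts it to
   the number of trials.  The argument 0 of Pi_pmf is only the default value outside {..<c}. *)

definition NegBin :: "nat \<Rightarrow> real \<Rightarrow> nat pmf" where
  "NegBin c q = map_pmf (\<lambda>X. \<Sum>i<c. X i) (Pi_pmf {..<c} 0 (\<lambda>_. map_pmf Suc (geometric_pmf q)))"

definition max_of :: "nat \<Rightarrow> (nat \<Rightarrow> 'a \<Rightarrow> nat) \<Rightarrow> 'a \<Rightarrow> nat" where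
  "max_of n Y \<omega> = Max ((\<lambda>j. Y j \<omega>) ` {1..n})"

definition mean_delay :: "'a measure \<Rightarrow> nat \<Rightarrow> nat \<Rightarrow> (nat \<Rightarrow> 'a \<Rightarrow> nat) \<Rightarrow> real" where
  "mean_delay M n c Y = 1 / real c * prob_space.expectation M (\<lambda>\<omega>. real (max_of n Y \<omega>))"

end

theory Submission
  imports Defs
begin

text \<open>
  Write the \<open>j\<close>-th reception time after \<open>c + 1\<close> packets as the row sum over \<open>i \<le> c\<close> of
  an array \<open>x j i\<close> of independent geometric variables. Deleting column \<open>k\<close> leaves row sums with
  the joint law of the \<open>c\<close>-packet reception times. Each \<open>x j i\<close> survives exactly \<open>c\<close> of the
  \<open>c + 1\<close> deletions, so \<open>c\<close> times the maximal full row sum is at most the sum over \<open>k\<close> of the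
  maximal row sums with column \<open>k\<close> deleted; now take expectations. The inequality is strict
  whenever no single row is maximal after every deletion, which happens with positive probability
  if there are at least two rows.
\<close>

subsection \<open>Maxima of leave-one-out sums\<close>

lemma sum_leave_one_out:
  fixes f :: "'a \<Rightarrow> nat"
  assumes "finite K"
  shows "(\<Sum>k\<in>K. \<Sum>i\<in>K - {k}. f i) = (card K - 1) * (\<Sum>i\<in>K. f i)"
proof -
  have "(\<Sum>k\<in>K. \<Sum>i\<in>K - {k}. f i) + (\<Sum>k\<in>K. f k) = (\<Sum>k\<in>K. \<Sum>i\<in>K. f i)"
    unfolding sum.distrib[symmetric]
    by (intro sum.cong refl) (simp add: sum.remove[OF assms])
  also have "\<dots> = card K * (\<Sum>i\<in>K. f i)"
    by simp
  finally show ?thesis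
    by (simp add: diff_mult_distrib)
qed

text \<open>A row \<open>j\<close> that is maximal for the full sum is one competitor after every
  deletion. The slack is zero only if this row stays maximal in all of them.\<close>

lemma Max_sum_le_leave_one_out:
  fixes x :: "'b \<Rightarrow> 'a \<Rightarrow> nat"
  assumes "finite J" "J \<noteq> {}" "finite K"
  shows "(card K - 1) * Max ((\<lambda>j. \<Sum>i\<in>K. x j i) ` J)
    \<le> (\<Sum>k\<in>K. Max ((\<lambda>j. \<Sum>i\<in>K - {k}. x j i) ` J))"
proof -
  have "Max ((\<lambda>j. \<Sum>i\<in>K. x j i) ` J) \<in> (\<lambda>j. \<Sum>i\<in>K. x j i) ` J"
    using assms by (intro Max_in) auto
  then obtain j where j: "j \<in> J" "Max ((\<lambda>j. \<Sum>i\<in>K. x j i) ` J) = (\<Sum>i\<in>K. x j i)"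
    by auto
  have "(\<Sum>k\<in>K. \<Sum>i\<in>K - {k}. x j i) \<le> (\<Sum>k\<in>K. Max ((\<lambda>j. \<Sum>i\<in>K - {k}. x j i) ` J))"
    using assms j by (intro sum_mono Max_ge) auto
  thus ?thesis
    using sum_leave_one_out[OF assms(3), of "x j"] j by simp
qed

text \<open>The base value is 1 rather than 0 because geometric variables counting trials are
  positive; the witness has to lie in their support.\<close>

definition spike :: "nat \<Rightarrow> nat \<Rightarrow> nat" where
  "spike k i = (if i = k then 2 else 1)"

lemma sum_spike: "finite A \<Longrightarrow> (\<Sum>i\<in>A. spike k i) = card A + (if k \<in> A then 1 else 0)"
proof -
  assume "finite A"
  moreover have "spike k i = 1 + (if i = k then 1 else 0)" for i
    by (simp add: spike_def)
  ultimately show ?thesis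
    by (simp only: sum.distrib sum.delta) simp
qed

text \<open>Rows 1 and 2 have their spikes in different columns, so every leave-one-out maximum keeps
  a spike.\<close>

lemma exists_strict_leave_one_out:
  assumes "2 \<le> n" "1 \<le> c"
  obtains x :: "nat \<Rightarrow> nat \<Rightarrow> nat"
  where "\<And>j i. 0 < x j i"
    "c * Max ((\<lambda>j. \<Sum>i\<le>c. x j i) ` {1..n})
      < (\<Sum>k\<le>c. Max ((\<lambda>j. \<Sum>i\<in>{..c} - {k}. x j i) ` {1..n}))"
proof -
  define x where "x j = spike (if j = 1 then 0 else 1)" for j :: nat
  have pos: "0 < x j i" for j i
    by (simp add: x_def spike_def)
  have le: "Max ((\<lambda>j. \<Sum>i\<le>c. x j i) ` {1..n}) \<le> c + 2"
    using assms by (subst Max_le_iff) (auto simp: x_def sum_spike)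
  have ge: "c + 1 \<le> Max ((\<lambda>j. \<Sum>i\<in>{..c} - {k}. x j i) ` {1..n})" if k: "k \<le> c" for k
  proof -
    \<comment> \<open>A row whose spike survives: row 1 has it in column 0, row 2 in column
      1.\<close>
    define j :: nat where "j = (if k = 0 then 2 else 1)"
    have "(\<Sum>i\<in>{..c} - {k}. x j i) = c + 1"
      using assms k by (auto simp: x_def j_def sum_spike)
    moreover have "(\<Sum>i\<in>{..c} - {k}. x j i) \<le> Max ((\<lambda>j. \<Sum>i\<in>{..c} - {k}. x j i) ` {1..n})"
      using assms by (intro Max_ge) (auto simp: j_def)
    ultimately show ?thesis by simp
  qed
  have "c * Max ((\<lambda>j. \<Sum>i\<le>c. x j i) ` {1..n}) \<le> c * (c + 2)"
    using le by (rule mult_le_mono2)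
  \<comment> \<open>The margin is exactly one:
    \<open>(c + 1) * (c + 1) = c * (c + 2) + 1\<close>.\<close>
  also have "\<dots> < (\<Sum>k\<le>c. c + 1)"
    by simp
  also have "\<dots> \<le> (\<Sum>k\<le>c. Max ((\<lambda>j. \<Sum>i\<in>{..c} - {k}. x j i) ` {1..n}))"
    using ge by (intro sum_mono) auto
  finally show ?thesis
    using that pos by blast
qed

subsection \<open>Arrays of geometric variables\<close>

text \<open>Both joint laws on \<open>J\<close> are the product of the same marginals. Outside
  \<open>J\<close>, \<open>Pi_pmf\<close> takes the value \<open>d\<close> while \<open>Y\<close> is
  arbitrary, so \<open>f\<close> may only look at coordinates in \<open>J\<close>.\<close>

lemma (in prob_space) expectation_indep_eq_Pi_pmf:
  fixes Y :: "'i \<Rightarrow> 'a \<Rightarrow> 'b :: countable" and f :: "('i \<Rightarrow> 'b) \<Rightarrow> real"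
  assumes J: "finite J" "J \<noteq> {}"
    and indep: "indep_vars (\<lambda>_. count_space UNIV) Y J"
    and law: "\<And>j. j \<in> J \<Longrightarrow> distr M (count_space UNIV) (Y j) = measure_pmf (p j)"
    and f: "\<And>y. f (restrict y J) = f y"
  shows "expectation (\<lambda>\<omega>. f (\<lambda>j. Y j \<omega>)) = measure_pmf.expectation (Pi_pmf J d p) f"
proof -
  let ?C = "\<lambda>_ :: 'i. count_space (UNIV :: 'b set)"
  let ?P = "measure_pmf (Pi_pmf J d p)"
  \<comment> \<open>A finite product of countable discrete spaces is discrete, which makes every
    \<open>f\<close> measurable.\<close>
  have C: "PiM J ?C = count_space (PiE J (\<lambda>_. UNIV))"
    using J by (intro count_space_PiM_finite) auto
  have fm: "f \<in> borel_measurable (PiM J ?C)"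
    by (simp add: C)
  have rv: "random_variable (?C j) (Y j)" if "j \<in> J" for j
    using indep that by (auto simp: indep_vars_def)
  have "distr M (PiM J ?C) (\<lambda>\<omega>. \<lambda>j\<in>J. Y j \<omega>) = PiM J (\<lambda>j. distr M (?C j) (Y j))"
    using indep_vars_iff_distr_eq_PiM'[of J Y ?C] J rv indep by simp
  also have "\<dots> = PiM J (\<lambda>j. measure_pmf (p j))"
    using law by (intro PiM_cong) auto
  also have "\<dots> = PiM J (\<lambda>j. distr ?P (?C j) (\<lambda>y. y j))"
  proof (intro PiM_cong refl)
    fix j assume "j \<in> J"
    thus "measure_pmf (p j) = distr ?P (?C j) (\<lambda>y. y j)"
      using Pi_pmf_component[OF J(1), of j d p]
      by (simp add: map_pmf_rep_eq[symmetric])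
  qed
  \<comment> \<open>The independence criterion again, now read backwards for the coordinates of
    \<open>Pi_pmf\<close>.\<close>
  also have "\<dots> = distr ?P (PiM J ?C) (\<lambda>y. \<lambda>j\<in>J. y j)"
    using prob_space.indep_vars_iff_distr_eq_PiM'[OF measure_pmf.prob_space_axioms,
        where I = J and X = "\<lambda>j y. y j" and M' = ?C] J indep_vars_Pi_pmf[OF J(1), of d p]
    by auto
  finally have eq: "distr M (PiM J ?C) (\<lambda>\<omega>. \<lambda>j\<in>J. Y j \<omega>) = distr ?P (PiM J ?C) (\<lambda>y. \<lambda>j\<in>J. y j)" .
  have "expectation (\<lambda>\<omega>. f (\<lambda>j. Y j \<omega>)) = expectation (\<lambda>\<omega>. f (\<lambda>j\<in>J. Y j \<omega>))"
    using f[of "\<lambda>j. Y j _"] by simp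
  also have "\<dots> = (\<integral>y. f y \<partial>distr M (PiM J ?C) (\<lambda>\<omega>. \<lambda>j\<in>J. Y j \<omega>))"
    using rv by (intro integral_distr[symmetric] fm measurable_restrict)
  also have "\<dots> = measure_pmf.expectation (Pi_pmf J d p) (\<lambda>y. f (\<lambda>j\<in>J. y j))"
    unfolding eq by (intro integral_distr fm measurable_restrict) simp
  also have "\<dots> = measure_pmf.expectation (Pi_pmf J d p) f"
    by (simp add: f)
  finally show ?thesis .
qed

text \<open>Rows are receivers and columns are packets. The nested product lets row sums be formed
  one row at a time.\<close>

definition geom_array :: "nat \<Rightarrow> nat \<Rightarrow> (nat \<Rightarrow> real) \<Rightarrow> (nat \<Rightarrow> nat \<Rightarrow> nat) pmf" where
  "geom_array n m q = Pi_pmf {1..n} (\<lambda>_. 0)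
     (\<lambda>j. Pi_pmf {..<m} 0 (\<lambda>_. map_pmf Suc (geometric_pmf (q j))))"

text \<open>Any \<open>c\<close> of \<open>c + 1\<close> i.i.d. variables are again i.i.d.; the
  increasing map \<open>h\<close> renumbers the columns, skipping \<open>k\<close>.\<close>

lemma NegBin_leave_one_out:
  assumes k: "k \<le> c"
  shows "NegBin c q = map_pmf (\<lambda>X. \<Sum>i\<in>{..c} - {k}. X i)
    (Pi_pmf {..<Suc c} 0 (\<lambda>_. map_pmf Suc (geometric_pmf q)))"
proof -
  let ?G = "\<lambda>_ :: nat. map_pmf Suc (geometric_pmf q)"
  define h where "h i = (if i < k then i else Suc i)" for i
  have "h ` {..<c} = {..c} - {k}"
  proof (intro equalityI subsetI)
    fix i assume "i \<in> {..c} - {k}"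
    hence "i = h (if i < k then i else i - 1)" "(if i < k then i else i - 1) < c"
      using k by (auto simp: h_def)
    thus "i \<in> h ` {..<c}" by blast
  qed (use k in \<open>auto simp: h_def split: if_splits\<close>)
  hence h: "bij_betw h {..<c} ({..c} - {k})"
    unfolding bij_betw_def by (auto simp: inj_on_def h_def split: if_splits)
  \<comment> \<open>The defaults agree too: as \<open>k \<le> c\<close>, indices from
    \<open>c\<close> on are sent beyond \<open>c\<close>.\<close>
  have "Pi_pmf {..<c} 0 ?G = map_pmf (\<lambda>g. g \<circ> h) (Pi_pmf ({..c} - {k}) 0 ?G)"
    using k by (intro Pi_pmf_bij_betw h) (auto simp: h_def)
  also have "Pi_pmf ({..c} - {k}) 0 ?G =
      map_pmf (\<lambda>f i. if i \<in> {..c} - {k} then f i else 0) (Pi_pmf {..<Suc c} 0 ?G)"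
    by (intro Pi_pmf_subset) auto
  finally have NegBin: "NegBin c q =
      map_pmf (\<lambda>f. \<Sum>i<c. if h i \<in> {..c} - {k} then f (h i) else 0) (Pi_pmf {..<Suc c} 0 ?G)"
    by (simp add: NegBin_def map_pmf_comp)
  have "(\<Sum>i<c. if h i \<in> {..c} - {k} then f (h i) else 0) = (\<Sum>i\<in>{..c} - {k}. f i)"
    for f :: "nat \<Rightarrow> nat"
    by (subst sum.reindex_bij_betw[OF h]) (intro sum.cong, auto)
  thus ?thesis
    unfolding NegBin by (simp only:)
qed

text \<open>Row-wise maps commute with the product because the default zero row has sum 0, the
  default on the left.\<close>

lemma Pi_pmf_NegBin:
  assumes "\<And>j. NegBin c (q j) = map_pmf (\<lambda>X. \<Sum>i\<in>I. X i)
    (Pi_pmf {..<m} 0 (\<lambda>_. map_pmf Suc (geometric_pmf (q j))))"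
  shows "Pi_pmf {1..n} 0 (\<lambda>j. NegBin c (q j)) = map_pmf (\<lambda>x j. \<Sum>i\<in>I. x j i) (geom_array n m q)"
  unfolding geom_array_def assms by (subst Pi_pmf_map[where dflt = "\<lambda>_. 0"]) (auto simp: o_def[abs_def])

text \<open>The column set \<open>I\<close> is left open so that block sizes \<open>c\<close> and
  \<open>c + 1\<close> can both be evaluated on one array law.\<close>

lemma mean_delay_eq_array:
  assumes "prob_space M" "1 \<le> n"
    and "prob_space.indep_vars M (\<lambda>_. count_space UNIV) Y {1..n}"
    and law: "\<And>j. j \<in> {1..n} \<Longrightarrow>
      distr M (count_space UNIV) (Y j) = measure_pmf (NegBin c (q j))"
    and I: "\<And>j. NegBin c (q j) = map_pmf (\<lambda>X. \<Sum>i\<in>I. X i)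
      (Pi_pmf {..<m} 0 (\<lambda>_. map_pmf Suc (geometric_pmf (q j))))"
  shows "mean_delay M n c Y = 1 / real c *
    measure_pmf.expectation (geom_array n m q) (\<lambda>x. real (Max ((\<lambda>j. \<Sum>i\<in>I. x j i) ` {1..n})))"
proof -
  interpret prob_space M by fact
  have "expectation (\<lambda>\<omega>. real (Max ((\<lambda>j. Y j \<omega>) ` {1..n}))) =
      measure_pmf.expectation (Pi_pmf {1..n} 0 (\<lambda>j. NegBin c (q j))) (\<lambda>y. real (Max (y ` {1..n})))"
    using assms by (intro expectation_indep_eq_Pi_pmf) auto
  thus ?thesis
    unfolding mean_delay_def max_of_def Pi_pmf_NegBin[OF I] by (simp add: image_image)
qed

lemma integrable_geom_array_entry:
  assumes "j \<in> {1..n}" "i < m" "q j \<in> {0<..<1}"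
  shows "integrable (geom_array n m q) (\<lambda>x. real (x j i))"
proof -
  have "map_pmf (\<lambda>x. x j i) (geom_array n m q) = map_pmf (\<lambda>X. X i) (map_pmf (\<lambda>x. x j) (geom_array n m q))"
    by (simp add: map_pmf_comp)
  also have "\<dots> = map_pmf Suc (geometric_pmf (q j))"
    using assms by (simp only: geom_array_def Pi_pmf_component finite_atLeastAtMost finite_lessThan if_True lessThan_iff)
  finally have eq: "map_pmf (\<lambda>x. x j i) (geom_array n m q) = map_pmf Suc (geometric_pmf (q j))" .
  have "integrable (geometric_pmf (q j)) (\<lambda>k. 1 + real k)"
    using assms integrable_real_geometric_pmf[of "q j"] by auto
  hence "integrable (map_pmf Suc (geometric_pmf (q j))) real"
    by simp
  thus ?thesis
    unfolding eq[symmetric] by simp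
qed

text \<open>The maximum of nonnegative row sums is dominated by the sum of all their entries, each
  of finite mean.\<close>

lemma integrable_geom_array_Max:
  assumes n: "1 \<le> n" and q: "\<And>j. j \<in> {1..n} \<Longrightarrow> q j \<in> {0<..<1}" and I: "I \<subseteq> {..<m}"
  shows "integrable (geom_array n m q) (\<lambda>x. real (Max ((\<lambda>j. \<Sum>i\<in>I. x j i) ` {1..n})))"
proof (rule Bochner_Integration.integrable_bound)
  show "integrable (geom_array n m q) (\<lambda>x. \<Sum>j\<in>{1..n}. \<Sum>i\<in>I. real (x j i))"
    using q I by (intro Bochner_Integration.integrable_sum integrable_geom_array_entry) auto
  have "Max ((\<lambda>j. \<Sum>i\<in>I. x j i) ` {1..n}) \<le> (\<Sum>j\<in>{1..n}. \<Sum>i\<in>I. x j i)" for x :: "nat \<Rightarrow> nat \<Rightarrow> nat"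
    using n by (subst Max_le_iff) (auto intro: member_le_sum)
  hence "real (Max ((\<lambda>j. \<Sum>i\<in>I. x j i) ` {1..n})) \<le> real (\<Sum>j\<in>{1..n}. \<Sum>i\<in>I. x j i)"
    for x :: "nat \<Rightarrow> nat \<Rightarrow> nat"
    by (simp only: of_nat_le_iff)
  thus "AE x in geom_array n m q. norm (real (Max ((\<lambda>j. \<Sum>i\<in>I. x j i) ` {1..n})))
      \<le> norm (\<Sum>j\<in>{1..n}. \<Sum>i\<in>I. real (x j i))"
    by (intro AE_I2) (simp add: sum_nonneg)
qed simp

text \<open>The shifted geometric law charges every positive integer; the zeros outside the block
  match the defaults of \<open>geom_array\<close>.\<close>

lemma geom_array_support:
  assumes q: "\<And>j. j \<in> {1..n} \<Longrightarrow> q j \<in> {0<..<1}" and x: "\<And>j i. 0 < x j i"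
  shows "(\<lambda>j i. if j \<in> {1..n} \<and> i < m then x j i else 0) \<in> set_pmf (geom_array n m q)"
proof -
  have "x j i \<in> range Suc" for j i
    using x[of j i] by (metis Suc_pred rangeI)
  moreover have "set_pmf (geometric_pmf (q j)) = UNIV" if "j \<in> {1..n}" for j
    using q[OF that] by (intro set_pmf_geometric) auto
  ultimately show ?thesis
    unfolding geom_array_def by (auto simp: set_Pi_pmf PiE_dflt_def)
qed

text \<open>For \<open>n = 1\<close> the mean delay is \<open>1 / q 1\<close> for every
  \<open>c\<close>, so strictness is claimed only from two receivers on. The spaces
  \<open>M c\<close> may differ, as only the law of each \<open>Y c\<close> enters.\<close>

theorem proposition16:
  fixes n :: nat and q :: "nat \<Rightarrow> real"
    and M :: "nat \<Rightarrow> 'a measure" and Y :: "nat \<Rightarrow> nat \<Rightarrow> 'a \<Rightarrow> nat"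
  assumes n: "n \<ge> 1"
    and q: "\<And>j. j \<in> {1..n} \<Longrightarrow> q j \<in> {0<..<1}"
    and M: "\<And>c. c \<ge> 1 \<Longrightarrow> prob_space (M c)"
    and indep: "\<And>c. c \<ge> 1 \<Longrightarrow>
      prob_space.indep_vars (M c) (\<lambda>_. count_space UNIV) (Y c) {1..n}"
    and law: "\<And>c j. c \<ge> 1 \<Longrightarrow> j \<in> {1..n} \<Longrightarrow>
      distr (M c) (count_space UNIV) (Y c j) = measure_pmf (NegBin c (q j))"
  shows "\<forall>c\<ge>1. mean_delay (M c) n c (Y c) - mean_delay (M (c + 1)) n (c + 1) (Y (c + 1)) \<ge> 0 \<and>
    (n \<ge> 2 \<longrightarrow> mean_delay (M c) n c (Y c) - mean_delay (M (c + 1)) n (c + 1) (Y (c + 1)) > 0)"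
proof (intro allI impI)
  fix c :: nat assume c: "c \<ge> 1"
  define A where "A = geom_array n (Suc c) q"
  define mx :: "nat set \<Rightarrow> (nat \<Rightarrow> nat \<Rightarrow> nat) \<Rightarrow> nat"
    where "mx I x = Max ((\<lambda>j. \<Sum>i\<in>I. x j i) ` {1..n})" for I x
  let ?E = "\<lambda>I. measure_pmf.expectation A (\<lambda>x. real (mx I x))"
  let ?D = "mean_delay (M c) n c (Y c)" and ?D' = "mean_delay (M (c + 1)) n (c + 1) (Y (c + 1))"
  \<comment> \<open>The pointwise slack of the leave-one-out inequality; its mean will be
    \<open>c * (c + 1)\<close> times the difference of the delays.\<close>
  define gap where "gap x = real (\<Sum>k\<le>c. mx ({..c} - {k}) x) - real (c * mx {..c} x)" for x
  have D': "?D' = 1 / (c + 1) * ?E {..c}"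
    using n c unfolding A_def mx_def
    by (subst mean_delay_eq_array[where I = "{..c}" and m = "Suc c" and q = q])
       (use indep[of "c + 1"] law[of "c + 1"] in \<open>auto simp: NegBin_def lessThan_Suc_atMost M\<close>)
  have "?D = 1 / c * ?E ({..c} - {k})" if "k \<le> c" for k
    using n c that unfolding A_def mx_def
    by (intro mean_delay_eq_array M indep law NegBin_leave_one_out)
  hence D: "?E ({..c} - {k}) = c * ?D" if "k \<le> c" for k
    using that c by simp
  have int: "integrable A (\<lambda>x. real (mx I x))" if "I \<subseteq> {..c}" for I
    unfolding A_def mx_def using n q that by (intro integrable_geom_array_Max) auto
  have int_gap: "integrable A gap"
    unfolding gap_def of_nat_sum of_nat_mult
    by (intro Bochner_Integration.integrable_diff Bochner_Integration.integrable_sum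
          integrable_mult_right int) auto
  have "measure_pmf.expectation A gap = (\<Sum>k\<le>c. ?E ({..c} - {k})) - c * ?E {..c}"
    unfolding gap_def of_nat_sum of_nat_mult
    by (subst Bochner_Integration.integral_diff)
       (auto intro!: Bochner_Integration.integrable_sum integrable_mult_right int
             simp: Bochner_Integration.integral_sum[OF int])
  also have "(\<Sum>k\<le>c. ?E ({..c} - {k})) = (\<Sum>k\<le>c. c * ?D)"
    by (intro sum.cong refl D) simp
  also have "c * ?E {..c} = c * ((c + 1) * ?D')"
    unfolding D' by simp
  finally have gap: "measure_pmf.expectation A gap = c * (c + 1) * (?D - ?D')"
    by (simp add: algebra_simps)
  have nonneg: "0 \<le> gap x" for x
    using Max_sum_le_leave_one_out[of "{1..n}" "{..c}" x] n
    unfolding gap_def mx_def by (simp only: diff_ge_0_iff_ge of_nat_le_iff) simp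
  have "0 \<le> measure_pmf.expectation A gap"
    using nonneg by simp
  moreover have "0 < real (c * (c + 1))"
    using c unfolding of_nat_0_less_iff by simp
  ultimately have "0 \<le> ?D - ?D'"
    unfolding gap by (simp only: zero_le_mult_iff) linarith
  moreover have "?D - ?D' \<noteq> 0" if n2: "n \<ge> 2"
  proof
    assume "?D - ?D' = 0"
    hence "measure_pmf.expectation A gap = 0"
      unfolding gap by simp
    \<comment> \<open>A nonnegative variable of mean zero vanishes almost surely, hence at every
      point of a discrete support.\<close>
    hence zero: "gap x = 0" if "x \<in> set_pmf A" for x
      using that nonneg integral_nonneg_eq_0_iff_AE[OF int_gap]
      by (simp add: AE_measure_pmf_iff)
    obtain x :: "nat \<Rightarrow> nat \<Rightarrow> nat" where x: "\<And>j i. 0 < x j i"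
      and less: "c * mx {..c} x < (\<Sum>k\<le>c. mx ({..c} - {k}) x)"
      unfolding mx_def using exists_strict_leave_one_out[OF n2 c] by blast
    \<comment> \<open>Cutting off outside the block puts the witness into the support and changes no
      sum over columns in \<open>{..c}\<close>.\<close>
    define x' where "x' j i = (if j \<in> {1..n} \<and> i < Suc c then x j i else 0)" for j i
    have "x' \<in> set_pmf A"
      unfolding A_def x'_def[abs_def] by (intro geom_array_support q x)
    moreover have "mx I x' = mx I x" if "I \<subseteq> {..c}" for I
      using that unfolding mx_def x'_def
      by (intro arg_cong[of _ _ Max] image_cong sum.cong refl) auto
    ultimately show False
      using zero[of x'] less by (simp add: gap_def flip: of_nat_sum of_nat_mult)
  qed
  ultimately show "?D - ?D' \<ge> 0 \<and> (n \<ge> 2 \<longrightarrow> ?D - ?D' > 0)"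
    by auto
qed

end
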